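(* Let $G=(V,E)$ be a finite, simple, connected $\delta$-regular graph with at least two vertices and let $\lambda^*$ be the second largest eigenvalue of its Laplacian $L$. Let $W$ be a nonempty proper subset of $V$ for which the Cheeger bound is sharp, i.e. $$\frac{|V|\,|E(W,V\setminus W)|}{\delta\,|W|\,|V\setminus W|}=-\lambda^*.$$ Then $W$ does not integrate the eigenspace of $L$ with eigenvalue $\lambda^*$.
   Context: $L=AD^{-1}-I$, where $A$ is the adjacency matrix of $G$ and $D$ its diagonal degree matrix. $E(W,V\setminus W)$ is the set of edges with one endpoint in $W$ and the other in $V\setminus W$. A nonempty $W\subset V$ integrates a function $\phi:V\to\mathbb{R}$ if $\frac{1}{|W|}\sum_{w\in W}\phi(w)=\frac{1}{|V|}\sum_{v\in V}\phi(v)$, and integrates an eigenspace of $L$ if it integrates every eigenvector in a basis of it. The Cheeger bound states that $\frac{|V||E(W,V\setminus W)|}{\delta|W||V\setminus W|}\ge-\lambda^*$ for every nonempty proper subset $W$ of $V$. *)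

theory Defs
  imports
    "HOL-Analysis.Analysis"
    "HOL-Computational_Algebra.Computational_Algebra"
    "Graph_Theory.Graph_Theory"
begin

text \<open>
  Finite simple graphs are the \<^locale>\<open>graph\<close>s of the AFP entry Graph_Theory: finite, loop-free,
  symmetric digraphs without parallel arcs, so an undirected edge is a pair of opposite arcs and
  the degree of a vertex is its \<^const>\<open>out_degree\<close>. The matrices below are indexed by the vertex
  type and describe a graph whose vertex set is all of that type, \<^prop>\<open>verts G = UNIV\<close>.
\<close>

definition adjacency_matrix :: "('v::finite, 'e) pre_digraph \<Rightarrow> real^'v^'v" where
  "adjacency_matrix G = (\<chi> u v. if u \<rightarrow>\<^bsub>G\<^esub> v then 1 else 0)"

definition degree_matrix :: "('v::finite, 'e) pre_digraph \<Rightarrow> real^'v^'v" where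
  "degree_matrix G = (\<chi> u v. if u = v then real (out_degree G u) else 0)"

definition laplacian :: "('v::finite, 'e) pre_digraph \<Rightarrow> real^'v^'v" where
  "laplacian G = adjacency_matrix G ** matrix_inv (degree_matrix G) - mat 1"

definition regular_graph :: "('v, 'e) pre_digraph \<Rightarrow> nat \<Rightarrow> bool" where
  "regular_graph G \<delta> \<longleftrightarrow> (\<forall>v\<in>verts G. out_degree G v = \<delta>)"

text \<open>The set \<open>E(U, W)\<close> of undirected edges, each being the two-element set of its endpoints.\<close>

definition edges_between :: "('v, 'e) pre_digraph \<Rightarrow> 'v set \<Rightarrow> 'v set \<Rightarrow> 'v set set" where
  "edges_between G U W = {{u, w} | u w. u \<in> U \<and> w \<in> W \<and> u \<rightarrow>\<^bsub>G\<^esub> w}"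

text \<open>The characteristic polynomial \<open>det (X I - M)\<close>, a determinant over the ring of polynomials.\<close>

definition charpoly :: "real^'n^'n \<Rightarrow> real poly" where
  "charpoly M = det (mat [:0, 1:] - (\<chi> i j. [:M $ i $ j:]))"

text \<open>The real eigenvalues in decreasing order, repeated according to algebraic multiplicity.\<close>

definition eigenvalues_desc :: "real^'n^'n \<Rightarrow> real list" where
  "eigenvalues_desc M = rev (sorted_list_of_multiset (proots (charpoly M)))"

text \<open>Positions in a list start at 0, so the second largest eigenvalue is at position 1.\<close>

definition second_largest_eigenvalue :: "real^'n^'n \<Rightarrow> real" where
  "second_largest_eigenvalue M = eigenvalues_desc M ! 1"

definition eigenspace :: "real^'n^'n \<Rightarrow> real \<Rightarrow> (real^'n) set" where
  "eigenspace M c = {x. M *v x = c *\<^sub>R x}"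

definition integrates :: "('v, 'e) pre_digraph \<Rightarrow> 'v set \<Rightarrow> ('v \<Rightarrow> real) \<Rightarrow> bool" where
  "integrates G W \<phi> \<longleftrightarrow>
     (\<Sum>w\<in>W. \<phi> w) / real (card W) = (\<Sum>v\<in>verts G. \<phi> v) / real (card (verts G))"

text \<open>
  Since \<^const>\<open>integrates\<close> is a linear condition on the function, it does not matter whether some
  basis or every basis is required to consist of integrated eigenvectors.
\<close>

definition integrates_eigenspace :: "('v::finite, 'e) pre_digraph \<Rightarrow> 'v set \<Rightarrow> real \<Rightarrow> bool" where
  "integrates_eigenspace G W c \<longleftrightarrow>
     (\<exists>B. independent B \<and> span B = eigenspace (laplacian G) c \<and>
          (\<forall>x\<in>B. integrates G W (\<lambda>v. x $ v)))"

end

theory Submission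
  imports Defs
begin

text \<open>
  Write \<open>n\<close> for the number of vertices. The proof looks at the centred indicator
  \<open>f = 1\<^sub>W - |W| / n\<close>, whose entries sum to 0. Counting the edges that leave \<open>W\<close> gives
  \<open>f \<bullet> L f = - |E(W, V - W)| / \<delta>\<close> and \<open>f \<bullet> f = |W| |V - W| / n\<close>, so the Cheeger bound is sharp
  for \<open>W\<close> exactly when the Rayleigh quotient of \<open>f\<close> is the second largest eigenvalue \<open>lam\<close>.

  The matrix \<open>L\<close> is symmetric and maps the orthogonal complement of the constants to itself.
  By compactness its Rayleigh quotient attains a maximum \<open>\<mu>\<close> there, and every vector at which this
  happens is an eigenvector (\<open>rayleigh_maximizer_eigenvector\<close>). Since the graph is connected,
  \<open>\<mu> < 0\<close>; so \<open>\<mu>\<close> and 0 are two different roots of the characteristic polynomial and the second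
  largest root, with multiplicity, is at least \<open>\<mu>\<close> (\<open>second_largest_eigenvalue_ge\<close>). Hence
  \<open>lam \<le> \<mu> \<le> lam\<close>, the vector \<open>f\<close> attains the maximum, and \<open>f\<close> lies in the eigenspace of \<open>lam\<close>.

  But \<open>W\<close> does not integrate \<open>f\<close>: the mean of \<open>f\<close> over the whole graph is 0 and its mean over \<open>W\<close>
  is \<open>1 - |W| / n > 0\<close>. As integration is a linear condition, it would pass from a basis of the
  eigenspace to \<open>f\<close>.
\<close>

section \<open>Rayleigh quotients of symmetric matrices\<close>

lemma symmetric_matrix_inner:
  fixes M :: "real^'n^'n"
  assumes "transpose M = M"
  shows "x \<bullet> (M *v y) = (M *v x) \<bullet> y"
  by (metis assms dot_lmul_matrix transpose_matrix_vector)

text \<open>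
  The form \<open>\<mu> (y \<bullet> y) - y \<bullet> M y\<close> is nonnegative on the subspace and vanishes at \<open>x\<close>. Moving from
  \<open>x\<close> a little way against the residual \<open>g = \<mu> x - M x\<close>, which lies in the subspace as well,
  changes it by \<open>- 2 t (g \<bullet> g)\<close> to first order, so \<open>g = 0\<close>.
\<close>

lemma rayleigh_maximizer_eigenvector:
  fixes M :: "real^'n^'n"
  assumes sym: "transpose M = M"
    and S: "subspace S"
    and inv: "\<And>y. y \<in> S \<Longrightarrow> M *v y \<in> S"
    and bound: "\<And>y. y \<in> S \<Longrightarrow> y \<bullet> (M *v y) \<le> \<mu> * (y \<bullet> y)"
    and x: "x \<in> S" "x \<bullet> (M *v x) = \<mu> * (x \<bullet> x)"
  shows "M *v x = \<mu> *\<^sub>R x"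
proof -
  define g where "g = \<mu> *\<^sub>R x - M *v x"
  define q where "q = \<mu> * (g \<bullet> g) - g \<bullet> (M *v g)"
  have g: "g \<in> S"
    unfolding g_def using S x inv by (simp add: subspace_diff subspace_scale)
  have q: "q \<ge> 0"
    using bound[OF g] by (simp add: q_def)
  have gg: "\<mu> * (g \<bullet> x) - g \<bullet> (M *v x) = g \<bullet> g"
    by (simp add: g_def inner_diff_right)
  have ineq: "2 * t * (g \<bullet> g) \<le> t\<^sup>2 * q" for t
  proof -
    have "x - t *\<^sub>R g \<in> S"
      using S x g by (simp add: subspace_diff subspace_scale)
    from bound[OF this]
    have "0 \<le> (\<mu> * (x \<bullet> x) - x \<bullet> (M *v x)) - 2 * t * (\<mu> * (g \<bullet> x) - g \<bullet> (M *v x)) + t\<^sup>2 * q"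
      using symmetric_matrix_inner[OF sym, of x g]
      by (simp add: q_def matrix_vector_mult_diff_distrib matrix_vector_mult_scaleR inner_diff_left
          inner_diff_right algebra_simps power2_eq_square inner_commute)
    then show ?thesis
      using x(2) gg by simp
  qed
  have "g \<bullet> g = 0"
  proof (rule ccontr)
    assume "g \<bullet> g \<noteq> 0"
    then have pos: "g \<bullet> g > 0"
      by simp
    \<comment> \<open>This step length makes the quadratic term at most half of the linear one.\<close>
    define t where "t = (g \<bullet> g) / (q + 1)"
    have t: "t > 0" and tq: "t * q \<le> g \<bullet> g"
      using pos q by (auto simp: t_def field_simps)
    have "t * (2 * (g \<bullet> g)) \<le> t * (t * q)"
      using ineq[of t] by (simp add: power2_eq_square mult_ac)
    then have "2 * (g \<bullet> g) \<le> t * q"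
      using t by simp
    then show False
      using tq pos by linarith
  qed
  then show ?thesis
    by (simp add: g_def)
qed

text \<open>The form \<open>y \<bullet> M y\<close> attains its maximum on the unit sphere of the subspace, which is compact.\<close>

lemma symmetric_matrix_top_eigenvector:
  fixes M :: "real^'n^'n"
  assumes sym: "transpose M = M"
    and S: "subspace S"
    and inv: "\<And>y. y \<in> S \<Longrightarrow> M *v y \<in> S"
    and z: "z \<in> S" "z \<noteq> 0"
  obtains \<mu> x where "x \<in> S" "x \<noteq> 0" "M *v x = \<mu> *\<^sub>R x"
    and "\<And>y. y \<in> S \<Longrightarrow> y \<bullet> (M *v y) \<le> \<mu> * (y \<bullet> y)"
proof -
  have norm_in: "y /\<^sub>R norm y \<in> S \<inter> sphere 0 1" if "y \<in> S" "y \<noteq> 0" for y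
    using that S by (simp add: subspace_scale)
  have "compact (S \<inter> sphere 0 1)"
    using S by (simp add: closed_Int_compact closed_subspace)
  moreover have "S \<inter> sphere 0 1 \<noteq> {}"
    using norm_in[OF z] by blast
  moreover have "continuous_on (S \<inter> sphere 0 1) (\<lambda>y. y \<bullet> (M *v y))"
    by (intro continuous_intros linear_continuous_on matrix_vector_mul_bounded_linear)
  ultimately obtain x where x: "x \<in> S \<inter> sphere 0 1"
    and max: "\<And>y. y \<in> S \<inter> sphere 0 1 \<Longrightarrow> y \<bullet> (M *v y) \<le> x \<bullet> (M *v x)"
    using continuous_attains_sup[of "S \<inter> sphere 0 1" "\<lambda>y. y \<bullet> (M *v y)"] by blast
  define \<mu> where "\<mu> = x \<bullet> (M *v x)"
  have bound: "y \<bullet> (M *v y) \<le> \<mu> * (y \<bullet> y)" if "y \<in> S" for y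
  proof (cases "y = 0")
    case False
    have "(y \<bullet> (M *v y)) / (y \<bullet> y) = (y /\<^sub>R norm y) \<bullet> (M *v (y /\<^sub>R norm y))"
      by (simp add: matrix_vector_mult_scaleR dot_square_norm power2_eq_square divide_inverse)
    also have "\<dots> \<le> \<mu>"
      using max[OF norm_in[OF that False]] by (simp add: \<mu>_def)
    finally show ?thesis
      using False by (simp add: divide_le_eq)
  qed simp
  have "x \<bullet> x = 1"
    using x by (simp add: dot_square_norm)
  then have "M *v x = \<mu> *\<^sub>R x"
    using x by (intro rayleigh_maximizer_eigenvector[OF sym S inv bound]) (auto simp: \<mu>_def)
  moreover have "x \<in> S" "x \<noteq> 0"
    using x by auto
  ultimately show thesis
    using bound by (intro that[of x \<mu>])
qed

section \<open>Eigenvalues as roots of the characteristic polynomial\<close>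

lemma poly_charpoly: "poly (charpoly M) c = det (mat c - M)"
  unfolding charpoly_def det_def
  by (simp add: poly_sum poly_prod mat_def if_distrib[where f = "\<lambda>p. poly p c"] cong: if_cong)

lemma mat_mult_vector: "mat c *v x = c *\<^sub>R (x :: real^'n)"
  by (simp add: vec_eq_iff matrix_vector_mult_def mat_def if_distrib[where f = "\<lambda>a. a * _"]
      cong: if_cong)

lemma charpoly_root_iff:
  "poly (charpoly M) c = 0 \<longleftrightarrow> (\<exists>x. x \<noteq> 0 \<and> M *v x = c *\<^sub>R x)"
proof -
  have "(mat c - M) *v x = 0 \<longleftrightarrow> M *v x = c *\<^sub>R x" for x
    by (auto simp: matrix_vector_mult_diff_rdistrib mat_mult_vector)
  then show ?thesis
    unfolding poly_charpoly
    using invertible_det_nz[of "mat c - M"] invertible_left_inverse[of "mat c - M"]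
      matrix_left_invertible_ker[of "mat c - M"] by metis
qed

text \<open>No number above the operator norm is an eigenvalue.\<close>

lemma charpoly_nonzero: "charpoly M \<noteq> 0"
proof
  assume "charpoly M = 0"
  then obtain x where x: "x \<noteq> 0" "M *v x = (onorm ((*v) M) + 1) *\<^sub>R x"
    using charpoly_root_iff[of M "onorm ((*v) M) + 1"] by auto
  have bl: "bounded_linear ((*v) M)"
    by (rule matrix_vector_mul_bounded_linear)
  have "(onorm ((*v) M) + 1) * norm x \<le> onorm ((*v) M) * norm x"
    using onorm[OF bl, of x] x(2) onorm_pos_le[OF bl] by simp
  then show False
    using x(1) by (simp add: distrib_right)
qed

lemma second_largest_in_list:
  fixes a b :: "'a::linorder"
  assumes "sorted xs" "a \<in> set xs" "b \<in> set xs" "a < b"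
  shows "a \<le> rev xs ! 1"
proof -
  obtain i j where i: "i < length xs" "xs ! i = a" and j: "j < length xs" "xs ! j = b"
    using assms by (metis in_set_conv_nth)
  have "i < j"
    using assms i j sorted_nth_mono[of xs j i] by (meson leD not_le_imp_less)
  then have "a \<le> xs ! (length xs - 2)"
    using i j assms(1) sorted_nth_mono[of xs i "length xs - 2"] by auto
  then show ?thesis
    using \<open>i < j\<close> j by (simp add: rev_nth numeral_2_eq_2)
qed

text \<open>
  Both \<open>a\<close> and \<open>b\<close> occur among the roots; in decreasing order \<open>b\<close> comes first, so \<open>a\<close> is at position
  1 or later.
\<close>

lemma second_largest_eigenvalue_ge:
  fixes M :: "real^'n^'n"
  assumes "x \<noteq> 0" "M *v x = a *\<^sub>R x" "y \<noteq> 0" "M *v y = b *\<^sub>R y" "a < b"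
  shows "a \<le> second_largest_eigenvalue M"
  unfolding second_largest_eigenvalue_def eigenvalues_desc_def
proof (rule second_largest_in_list[OF _ _ _ \<open>a < b\<close>])
  show "a \<in> set (sorted_list_of_multiset (proots (charpoly M)))"
    "b \<in> set (sorted_list_of_multiset (proots (charpoly M)))"
    using assms charpoly_root_iff[of M] charpoly_nonzero[of M] by auto
qed simp

section \<open>The Laplacian of a regular graph\<close>

lemma (in digraph) out_degree_eq_card_successors: "out_degree G u = card {v. u \<rightarrow>\<^bsub>G\<^esub> v}"
proof -
  have "inj_on (head G) (out_arcs G u)"
    using no_multi_arcs by (auto intro!: inj_onI simp: arc_to_ends_def)
  moreover have "head G ` out_arcs G u = {v. u \<rightarrow>\<^bsub>G\<^esub> v}"
    by (auto simp: arcs_ends_conv)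
  ultimately show ?thesis
    unfolding out_degree_def by (metis card_image)
qed

lemma connected_graph_constant:
  assumes "graph G" "Digraph_Component.connected G" "u \<in> verts G" "v \<in> verts G"
    and adj: "\<And>u v. u \<rightarrow>\<^bsub>G\<^esub> v \<Longrightarrow> h u = h v"
  shows "h u = h v"
proof -
  interpret graph G by fact
  have "u \<rightarrow>\<^sup>*\<^bsub>G\<^esub> v"
    using symmetric_connected_imp_strongly_connected[OF sym_arcs assms(2)] assms(3,4) by auto
  then show ?thesis
    by (induction rule: reachable_induct) (auto dest: adj)
qed

lemma adjacency_matrix_symmetric:
  assumes "graph G"
  shows "adjacency_matrix G $ u $ v = adjacency_matrix G $ v $ u"
proof -
  interpret graph G by fact
  show ?thesis
    using arcs_ends_symmetric[OF sym_arcs] by (auto simp: adjacency_matrix_def)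
qed

lemma adjacency_matrix_row_sum:
  fixes G :: "('v::finite, 'e) pre_digraph"
  assumes "graph G" "regular_graph G \<delta>" "verts G = UNIV"
  shows "(\<Sum>v\<in>UNIV. adjacency_matrix G $ u $ v) = real \<delta>"
proof -
  interpret graph G by fact
  show ?thesis
    using assms(2,3) out_degree_eq_card_successors[of u]
    by (simp add: adjacency_matrix_def regular_graph_def sum.If_cases)
qed

lemma laplacian_regular:
  fixes G :: "('v::finite, 'e) pre_digraph"
  assumes "regular_graph G \<delta>" "verts G = UNIV" "\<delta> > 0"
  shows "laplacian G = (1 / real \<delta>) *\<^sub>R adjacency_matrix G - mat 1"
proof -
  define D :: "real^'v^'v" where "D = mat (real \<delta>)"
  have mat_mat: "mat a ** mat b = (mat (a * b) :: real^'v^'v)" for a b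
    by (simp add: vec_eq_iff matrix_matrix_mult_def mat_def if_distrib[where f = "\<lambda>a. a * _"]
        cong: if_cong)
  have "degree_matrix G = D"
    using assms by (simp add: degree_matrix_def regular_graph_def D_def mat_def vec_eq_iff)
  moreover have "D ** mat (1 / real \<delta>) = mat 1" "mat (1 / real \<delta>) ** D = mat 1"
    using assms(3) by (simp_all add: D_def mat_mat)
  then have "D ** matrix_inv D = mat 1 \<and> matrix_inv D ** D = mat 1"
    unfolding matrix_inv_def by (rule_tac someI[of _ "mat (1 / real \<delta>)"]) simp
  then have "matrix_inv D = mat (1 / real \<delta>)"
    using \<open>mat (1 / real \<delta>) ** D = mat 1\<close> by (metis matrix_mul_assoc matrix_mul_lid matrix_mul_rid)
  moreover have "A ** mat c = c *\<^sub>R A" for A :: "real^'v^'v" and c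
    by (simp add: vec_eq_iff matrix_matrix_mult_def mat_def if_distrib[where f = "\<lambda>a. _ * a"]
        cong: if_cong)
  ultimately show ?thesis
    by (simp add: laplacian_def)
qed

text \<open>
  Expanding the square in the sum over ordered pairs of adjacent vertices, each square \<open>(x $ u)\<^sup>2\<close>
  occurs \<open>2 \<delta>\<close> times and each product \<open>x $ u * x $ v\<close> occurs with factor \<open>- 2\<close>.
\<close>

lemma laplacian_dirichlet_form:
  fixes G :: "('v::finite, 'e) pre_digraph"
  assumes "graph G" "regular_graph G \<delta>" "verts G = UNIV" "\<delta> > 0"
  shows "x \<bullet> (laplacian G *v x) =
    - (\<Sum>u\<in>UNIV. \<Sum>v\<in>UNIV. adjacency_matrix G $ u $ v * (x $ u - x $ v)\<^sup>2) / (2 * real \<delta>)"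
proof -
  define a where "a u v = adjacency_matrix G $ u $ v" for u v
  have row: "(\<Sum>v\<in>UNIV. a u v) = real \<delta>" for u
    unfolding a_def by (rule adjacency_matrix_row_sum[OF assms(1-3)])
  have rows: "(\<Sum>u\<in>UNIV. \<Sum>v\<in>UNIV. a u v * (x $ u)\<^sup>2) = real \<delta> * (x \<bullet> x)"
    by (simp add: inner_vec_def power2_eq_square row flip: sum_distrib_right sum_distrib_left)
  have "(\<Sum>u\<in>UNIV. \<Sum>v\<in>UNIV. a u v * (x $ v)\<^sup>2) = (\<Sum>v\<in>UNIV. \<Sum>u\<in>UNIV. a v u * (x $ v)\<^sup>2)"
    unfolding a_def by (subst sum.swap) (simp add: adjacency_matrix_symmetric[OF assms(1)])
  then have columns: "(\<Sum>u\<in>UNIV. \<Sum>v\<in>UNIV. a u v * (x $ v)\<^sup>2) = real \<delta> * (x \<bullet> x)"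
    using rows by simp
  have mixed: "(\<Sum>u\<in>UNIV. \<Sum>v\<in>UNIV. a u v * (x $ u * x $ v)) = x \<bullet> (adjacency_matrix G *v x)"
    by (simp add: inner_vec_def matrix_vector_mult_def a_def sum_distrib_left mult_ac)
  have "(\<Sum>u\<in>UNIV. \<Sum>v\<in>UNIV. a u v * (x $ u - x $ v)\<^sup>2) =
      (\<Sum>u\<in>UNIV. \<Sum>v\<in>UNIV. a u v * (x $ u)\<^sup>2) + (\<Sum>u\<in>UNIV. \<Sum>v\<in>UNIV. a u v * (x $ v)\<^sup>2)
      - 2 * (\<Sum>u\<in>UNIV. \<Sum>v\<in>UNIV. a u v * (x $ u * x $ v))"
    by (simp add: sum_distrib_left algebra_simps power2_diff flip: sum.distrib sum_subtractf)
  also have "\<dots> = 2 * real \<delta> * (x \<bullet> x) - 2 * (x \<bullet> (adjacency_matrix G *v x))"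
    unfolding rows columns mixed by simp
  finally have square: "(\<Sum>u\<in>UNIV. \<Sum>v\<in>UNIV. a u v * (x $ u - x $ v)\<^sup>2) =
      2 * real \<delta> * (x \<bullet> x) - 2 * (x \<bullet> (adjacency_matrix G *v x))" .
  have "x \<bullet> (laplacian G *v x) = (x \<bullet> (adjacency_matrix G *v x)) / real \<delta> - x \<bullet> x"
    unfolding laplacian_regular[OF assms(2-4)]
    by (simp add: matrix_vector_mult_diff_rdistrib inner_diff_right
        flip: scaleR_matrix_vector_assoc)
  then show ?thesis
    using assms(4) square by (simp add: a_def field_simps)
qed

lemma laplacian_symmetric:
  fixes G :: "('v::finite, 'e) pre_digraph"
  assumes "graph G" "regular_graph G \<delta>" "verts G = UNIV" "\<delta> > 0"
  shows "transpose (laplacian G) = laplacian G"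
  using laplacian_regular[OF assms(2-4)] adjacency_matrix_symmetric[OF assms(1)]
  by (simp add: transpose_def vec_eq_iff mat_def)

lemma laplacian_constant:
  fixes G :: "('v::finite, 'e) pre_digraph"
  assumes "graph G" "regular_graph G \<delta>" "verts G = UNIV" "\<delta> > 0"
  shows "laplacian G *v 1 = 0"
proof -
  have "adjacency_matrix G *v 1 = real \<delta> *\<^sub>R 1"
    using adjacency_matrix_row_sum[OF assms(1-3)] by (simp add: vec_eq_iff matrix_vector_mult_def)
  then show ?thesis
    using assms(4) laplacian_regular[OF assms(2-4)]
    by (simp add: matrix_vector_mult_diff_rdistrib flip: scaleR_matrix_vector_assoc)
qed

text \<open>If all the squared differences along edges vanish, connectedness makes the vector constant.\<close>

lemma laplacian_negative_on_mean_zero: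
  fixes G :: "('v::finite, 'e) pre_digraph"
  assumes G: "graph G" "regular_graph G \<delta>" "verts G = UNIV" "\<delta> > 0"
    and conn: "Digraph_Component.connected G"
    and x: "1 \<bullet> x = 0" "x \<noteq> 0"
  shows "x \<bullet> (laplacian G *v x) < 0"
proof (rule ccontr)
  define a where "a u v = adjacency_matrix G $ u $ v * (x $ u - x $ v)\<^sup>2" for u v
  assume "\<not> x \<bullet> (laplacian G *v x) < 0"
  then have le: "(\<Sum>u\<in>UNIV. \<Sum>v\<in>UNIV. a u v) \<le> 0"
    using G(4) by (simp add: laplacian_dirichlet_form[OF G] a_def field_simps)
  have nonneg: "a u v \<ge> 0" for u v
    by (simp add: a_def adjacency_matrix_def)
  then have zero: "(\<Sum>u\<in>UNIV. \<Sum>v\<in>UNIV. a u v) = 0"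
    using le by (intro antisym sum_nonneg) auto
  have a_zero: "a u v = 0" for u v
  proof -
    have "(\<Sum>v\<in>UNIV. a u v) = 0"
      using zero nonneg by (simp add: sum_nonneg_eq_0_iff sum_nonneg)
    then show ?thesis
      using nonneg by (simp add: sum_nonneg_eq_0_iff)
  qed
  have "x $ u = x $ v" if "u \<rightarrow>\<^bsub>G\<^esub> v" for u v
    using that a_zero[of u v] by (simp add: a_def adjacency_matrix_def)
  then have const: "x $ u = x $ v" for u v
    using connected_graph_constant[OF G(1) conn, of u v "($) x"] G(3) by auto
  have "x $ u = 0" for u
  proof -
    have "1 \<bullet> x = (\<Sum>v\<in>(UNIV::'v set). x $ u)"
      unfolding inner_vec_def by (intro sum.cong refl) (simp, rule const)
    then show ?thesis
      using x(1) by simp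
  qed
  then show False
    using x(2) by (simp add: vec_eq_iff)
qed

section \<open>The cut of a set of vertices\<close>

lemma card_edges_between_complement:
  fixes G :: "('v::finite, 'e) pre_digraph"
  shows "real (card (edges_between G W (- W))) =
    (\<Sum>u\<in>W. \<Sum>v\<in>- W. adjacency_matrix G $ u $ v)"
proof -
  define P where "P = (SIGMA u:W. {v \<in> - W. u \<rightarrow>\<^bsub>G\<^esub> v})"
  have "edges_between G W (- W) = (\<lambda>(u, v). {u, v}) ` P"
    by (auto simp: edges_between_def P_def)
  \<comment> \<open>An edge of the cut has exactly one orientation that starts in \<open>W\<close>.\<close>
  moreover have "inj_on (\<lambda>(u, v). {u, v}) P"
    by (auto simp: inj_on_def P_def doubleton_eq_iff)
  ultimately have "card (edges_between G W (- W)) = card P"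
    by (simp add: card_image)
  also have "\<dots> = (\<Sum>u\<in>W. card {v \<in> - W. u \<rightarrow>\<^bsub>G\<^esub> v})"
    unfolding P_def by (rule card_SigmaI) auto
  finally show ?thesis
    by (simp add: adjacency_matrix_def sum.If_cases Int_def)
qed

lemma sum_indicator_UNIV: "(\<Sum>v\<in>UNIV. indicator W v) = real (card (W :: 'v::finite set))"
  by (simp add: indicator_def sum.If_cases)

definition centred_indicator :: "'v set \<Rightarrow> real^'v::finite" where
  "centred_indicator W = (\<chi> v. indicator W v - real (card W) / real CARD('v))"

lemma centred_indicator_mean_zero: "1 \<bullet> centred_indicator W = 0"
  by (simp add: centred_indicator_def inner_vec_def sum_subtractf sum_indicator_UNIV)

lemma centred_indicator_norm:
  fixes W :: "'v::finite set"
  shows "centred_indicator W \<bullet> centred_indicator W =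
    real (card W) * real (card (- W)) / real CARD('v)"
proof -
  define c where "c = real (card W) / real CARD('v)"
  have "(indicator W v - c)\<^sup>2 = (1 - 2 * c) * indicator W v + c\<^sup>2" for v
    by (simp add: indicator_def power2_eq_square algebra_simps)
  then have "centred_indicator W \<bullet> centred_indicator W =
      (\<Sum>v\<in>UNIV. (1 - 2 * c) * indicator W v + c\<^sup>2)"
    by (simp add: centred_indicator_def inner_vec_def c_def flip: power2_eq_square)
  also have "\<dots> = (1 - 2 * c) * real (card W) + real CARD('v) * c\<^sup>2"
    by (simp add: sum.distrib sum_indicator_UNIV flip: sum_distrib_left)
  also have "\<dots> = real (card W) * (real CARD('v) - real (card W)) / real CARD('v)"
    by (simp add: c_def power2_eq_square field_simps)
  also have "real CARD('v) - real (card W) = real (card (- W))"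
    by (simp add: Compl_eq_Diff_UNIV card_Diff_subset of_nat_diff card_mono)
  finally show ?thesis .
qed

text \<open>
  Across an edge the centred indicator jumps by 1 if the edge is in the cut and by 0 otherwise;
  the sum over ordered pairs counts every edge of the cut twice.
\<close>

lemma centred_indicator_dirichlet_form:
  fixes G :: "('v::finite, 'e) pre_digraph"
  assumes G: "graph G" "regular_graph G \<delta>" "verts G = UNIV" "\<delta> > 0"
  shows "centred_indicator W \<bullet> (laplacian G *v centred_indicator W) =
    - real (card (edges_between G W (- W))) / real \<delta>"
proof -
  define f where "f = (centred_indicator W :: real^'v)"
  define a where "a u v = adjacency_matrix G $ u $ v" for u v
  define cut where "cut = (\<Sum>u\<in>W. \<Sum>v\<in>- W. a u v)"
  have jump: "(f $ u - f $ v)\<^sup>2 = indicator W u * indicator (- W) v + indicator (- W) u * indicator W v"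
    for u v
    by (simp add: f_def centred_indicator_def indicator_def)
  have restrict: "(\<Sum>u\<in>UNIV. \<Sum>v\<in>UNIV. a u v * (indicator A u * indicator B v)) =
      (\<Sum>u\<in>A. \<Sum>v\<in>B. a u v)" for A B
  proof -
    have "(\<Sum>v\<in>UNIV. a u v * (indicator A u * indicator B v)) =
        (if u \<in> A then \<Sum>v\<in>B. a u v else 0)" for u
      by (simp add: indicator_def sum.If_cases if_distrib[where f = "\<lambda>t. _ * t"] cong: if_cong)
    then show ?thesis
      by (simp add: sum.If_cases)
  qed
  have "(\<Sum>u\<in>UNIV. \<Sum>v\<in>UNIV. a u v * (f $ u - f $ v)\<^sup>2) = cut + (\<Sum>u\<in>- W. \<Sum>v\<in>W. a u v)"
    by (simp only: jump distrib_left sum.distrib restrict cut_def)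
  also have "(\<Sum>u\<in>- W. \<Sum>v\<in>W. a u v) = cut"
    unfolding cut_def a_def by (subst sum.swap) (simp add: adjacency_matrix_symmetric[OF G(1)])
  finally show ?thesis
    using card_edges_between_complement[of G W]
    by (simp add: laplacian_dirichlet_form[OF G] f_def a_def cut_def)
qed

section \<open>Sharp sets do not integrate the second eigenspace\<close>

lemma integrates_span:
  fixes B :: "(real^'v::finite) set" and x :: "real^'v"
  assumes "\<And>x. x \<in> B \<Longrightarrow> integrates G W (\<lambda>v. x $ v)" "x \<in> span B"
  shows "integrates G W (\<lambda>v. x $ v)"
proof -
  have "subspace {x :: real^'v. integrates G W (\<lambda>v. x $ v)}"
    by (auto simp: subspace_def integrates_def sum.distrib add_divide_distrib
        simp flip: sum_distrib_left times_divide_eq_right)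
  then show ?thesis
    using span_minimal[of B "{x. integrates G W (\<lambda>v. x $ v)}"] assms by blast
qed

lemma not_integrates_centred_indicator:
  fixes W :: "'v::finite set"
  assumes "verts G = UNIV" "W \<noteq> {}" "W \<noteq> UNIV"
  shows "\<not> integrates G W (\<lambda>v. centred_indicator W $ v)"
proof -
  have "card W > 0" "card W < CARD('v)"
    using assms psubset_card_mono[of UNIV W] by (auto simp: card_gt_0_iff)
  moreover have "(\<Sum>v\<in>UNIV. centred_indicator W $ v) = 0"
    using centred_indicator_mean_zero[of W] by (simp add: inner_vec_def)
  moreover have "(\<Sum>v\<in>W. centred_indicator W $ v) = card W * (1 - card W / CARD('v))"
    by (simp add: centred_indicator_def algebra_simps)
  ultimately show ?thesis
    using assms(2) by (simp add: integrates_def assms(1))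
qed

theorem theorem5p11:
  fixes G :: "('v::finite, 'e) pre_digraph"
    and \<delta> :: nat
    and W :: "'v set"
    and lam :: real
  assumes "graph G"
    and "verts G = UNIV"
    and "Digraph_Component.connected G"
    and "card (verts G) \<ge> 2"
    and "regular_graph G \<delta>"
    and "lam = second_largest_eigenvalue (laplacian G)"
    and "W \<noteq> {}"
    and "W \<subset> verts G"
    and "real (card (verts G)) * real (card (edges_between G W (verts G - W)))
           / (real \<delta> * real (card W) * real (card (verts G - W))) = - lam"
  shows "\<not> integrates_eigenspace G W lam"
proof
  assume "integrates_eigenspace G W lam"
  then obtain B :: "(real^'v) set" where B: "span B = eigenspace (laplacian G) lam"
    "\<And>x. x \<in> B \<Longrightarrow> integrates G W (\<lambda>v. x $ v)"
    by (auto simp: integrates_eigenspace_def)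
  interpret graph G by fact
  have W: "W \<noteq> UNIV"
    using assms(2,8) by auto
  have "\<delta> \<noteq> 0"
  proof
    \<comment> \<open>Without edges, even membership in \<open>W\<close> would be constant on the connected graph.\<close>
    assume "\<delta> = 0"
    then have "\<not> u \<rightarrow>\<^bsub>G\<^esub> v" for u v
      using assms(2,5) out_degree_eq_card_successors[of u] by (auto simp: regular_graph_def)
    then have "(u \<in> W) = (v \<in> W)" for u v
      using connected_graph_constant[OF assms(1,3), of u v "\<lambda>v. v \<in> W"] assms(2) by blast
    then show False
      using assms(7) W by blast
  qed
  then have \<delta>: "\<delta> > 0"
    by simp
  note G = assms(1,5,2) \<delta>
  define L where "L = laplacian G"
  define f where "f = (centred_indicator W :: real^'v)"
  define S where "S = {x :: real^'v. 1 \<bullet> x = 0}"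
  have symL: "transpose L = L"
    unfolding L_def by (rule laplacian_symmetric[OF G])
  have L1: "L *v 1 = 0"
    unfolding L_def by (rule laplacian_constant[OF G])
  have S: "subspace S"
    unfolding S_def by (rule subspace_hyperplane)
  have invS: "L *v y \<in> S" for y
    using symmetric_matrix_inner[OF symL, of 1 y] L1 by (simp add: S_def)
  have "- W \<noteq> {}"
    using W by auto
  then have ff: "f \<bullet> f > 0"
    using assms(7) by (simp add: f_def centred_indicator_norm card_gt_0_iff)
  have fS: "f \<in> S"
    by (simp add: S_def f_def centred_indicator_mean_zero)
  have fLf: "f \<bullet> (L *v f) = lam * (f \<bullet> f)"
  proof -
    have "lam = - (real CARD('v) * real (card (edges_between G W (- W)))
           / (real \<delta> * real (card W) * real (card (- W))))"
      using assms(2,9) by (simp add: Compl_eq_Diff_UNIV)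
    then show ?thesis
      using \<delta> \<open>W \<noteq> {}\<close> \<open>- W \<noteq> {}\<close>
      by (simp add: f_def L_def centred_indicator_norm centred_indicator_dirichlet_form[OF G])
  qed
  obtain \<mu> x where x: "x \<in> S" "x \<noteq> 0" "L *v x = \<mu> *\<^sub>R x"
    and bound: "\<And>y. y \<in> S \<Longrightarrow> y \<bullet> (L *v y) \<le> \<mu> * (y \<bullet> y)"
    using symmetric_matrix_top_eigenvector[OF symL S invS fS] ff by (metis inner_zero_left less_irrefl)
  have "\<mu> * (x \<bullet> x) < 0"
    using laplacian_negative_on_mean_zero[OF G assms(3), of x] x by (simp add: S_def L_def)
  then have "\<mu> < 0"
    using inner_ge_zero[of x] by (auto simp: mult_less_0_iff)
  moreover have "(1 :: real^'v) \<noteq> 0"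
    by (simp add: vec_eq_iff)
  ultimately have "\<mu> \<le> lam"
    using second_largest_eigenvalue_ge[of x L \<mu> 1 0] x L1 by (simp add: assms(6) L_def)
  moreover have "lam \<le> \<mu>"
    using bound[OF fS] fLf ff by simp
  ultimately have "\<mu> = lam"
    by simp
  then have "L *v f = lam *\<^sub>R f"
    using rayleigh_maximizer_eigenvector[OF symL S invS bound fS] fLf by simp
  then have "f \<in> span B"
    by (simp add: B(1) eigenspace_def L_def)
  then have "integrates G W (\<lambda>v. f $ v)"
    using B(2) by (rule integrates_span[rotated])
  then show False
    using not_integrates_centred_indicator[OF assms(2,7) W] by (simp add: f_def)
qed

end
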